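(* Let $M$ be a matroid on the ground set $E=[n]$ of rank $k<n$. Then \[ \widehat{\alpha}(I_{\Delta(M)})=\min_{r\in[n-k]}\left\{\frac{d_r(M)}{r}\right\}. \]
   Context: $[m]=\{1,\dots,m\}$. For $r\in[n-k]$ the $r$-th generalized Hamming weight of $M$ is $d_r(M)=\min\{|U| : U\subseteq E,\ |U|-\mathrm{rk}_M(U)=r\}$. Let $S=\mathbb{L}[x_1,\dots,x_n]$ be a polynomial ring over a field $\mathbb{L}$; for $U\subseteq E$ put $x^U=\prod_{u\in U}x_u$ and $P_U=\langle x_u: u\in U\rangle$. $\Delta(M)$ is the independence complex of $M$ and $I_{\Delta(M)}=\langle x^C: C \text{ a circuit of } M\rangle=\bigcap_{B\in\mathcal{B}(M^* )}P_B$ is its Stanley-Reisner ideal, where $\mathcal{B}(M^* )$ is the set of bases of the dual matroid $M^*$; its $s$-th symbolic power is $I_{\Delta(M)}^{(s)}=\bigcap_{B\in\mathcal{B}(M^* )}P_B^s$. For a nonzero homogeneous ideal $I$, $\alpha(I)$ is the smallest degree of a nonzero homogeneous element of $I$, and the Waldschmidt constant is $\widehat{\alpha}(I)=\lim_{s\to\infty}\alpha(I^{(s)})/s$ (the limit exists). *)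

theory Defs
  imports Complex_Main "HOL-Algebra.Ideal_Product" "HOL-Library.Poly_Mapping"
begin

section \<open>Matroids\<close>

locale matroid =
  fixes E :: "'a set" and Ind :: "'a set set"
  assumes finite_ground: "finite E"
    and indep_subset_ground: "X \<in> Ind \<Longrightarrow> X \<subseteq> E"
    and indep_empty: "{} \<in> Ind"
    and indep_subset: "X \<in> Ind \<Longrightarrow> Y \<subseteq> X \<Longrightarrow> Y \<in> Ind"
    and indep_augment:
      "X \<in> Ind \<Longrightarrow> Y \<in> Ind \<Longrightarrow> card X < card Y \<Longrightarrow> \<exists>y\<in>Y - X. insert y X \<in> Ind"

definition matroid_bases :: "'a set set \<Rightarrow> 'a set set" where
  "matroid_bases Ind = {B \<in> Ind. \<forall>X\<in>Ind. B \<subseteq> X \<longrightarrow> X = B}"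

definition matroid_circuits :: "'a set \<Rightarrow> 'a set set \<Rightarrow> 'a set set" where
  "matroid_circuits E Ind = {C. C \<subseteq> E \<and> C \<notin> Ind \<and> (\<forall>X. X \<subset> C \<longrightarrow> X \<in> Ind)}"

definition matroid_rank :: "'a set set \<Rightarrow> 'a set \<Rightarrow> nat" where
  "matroid_rank Ind U = Max (card ` {X \<in> Ind. X \<subseteq> U})"

text \<open>The independent sets of the dual matroid: the subsets of complements of bases.\<close>

definition dual_indep :: "'a set \<Rightarrow> 'a set set \<Rightarrow> 'a set set" where
  "dual_indep E Ind = {X. \<exists>B\<in>matroid_bases Ind. X \<subseteq> E - B}"

text \<open>The subtraction does not truncate, since the rank of a set is at most its size.\<close>

definition gen_hamming_weight :: "'a set \<Rightarrow> 'a set set \<Rightarrow> nat \<Rightarrow> nat" where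
  "gen_hamming_weight E Ind r = Min {card U | U. U \<subseteq> E \<and> card U - matroid_rank Ind U = r}"


section \<open>Polynomial rings and monomial ideals\<close>

text \<open>A polynomial is a finitely supported map from exponent vectors to coefficients. The ring
  \<open>mpoly_ring E\<close> consists of the polynomials in the variables indexed by \<open>E\<close> only.\<close>

abbreviation "keys \<equiv> Poly_Mapping.keys"
abbreviation "lookup \<equiv> Poly_Mapping.lookup"

type_synonym ('a, 'l) mpolynomial = "('a \<Rightarrow>\<^sub>0 nat) \<Rightarrow>\<^sub>0 'l"

definition mpoly_ring :: "'a set \<Rightarrow> ('a, 'l::comm_ring_1) mpolynomial ring" where
  "mpoly_ring E = \<lparr>carrier = {p. \<forall>m\<in>keys p. keys m \<subseteq> E},
    monoid.mult = (*), one = 1, ring.zero = 0, add = (+)\<rparr>"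

definition mvar :: "'a \<Rightarrow> ('a, 'l::comm_ring_1) mpolynomial" where
  "mvar i = Poly_Mapping.single (Poly_Mapping.single i 1) 1"

definition var_ideal ::
    "('a, 'l::comm_ring_1) mpolynomial ring \<Rightarrow> 'a set \<Rightarrow> ('a, 'l) mpolynomial set" where
  "var_ideal S U = Idl\<^bsub>S\<^esub> (mvar ` U)"

definition stanley_reisner_ideal ::
    "('a, 'l::comm_ring_1) mpolynomial ring \<Rightarrow> 'a set \<Rightarrow> 'a set set \<Rightarrow> ('a, 'l) mpolynomial set"
  where "stanley_reisner_ideal S E Ind = Idl\<^bsub>S\<^esub> {\<Prod>i\<in>C. mvar i | C. C \<in> matroid_circuits E Ind}"

text \<open>The symbolic powers of the Stanley-Reisner ideal. Lemma
  \<open>stanley_reisner_ideal_eq_Inter\<close> below states the decomposition they are based on. Powers of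
  ideals are taken in the library's semiring of ideals, so that \<open>P [^] 0\<close> is the whole ring.\<close>

definition stanley_reisner_symbolic_power ::
    "('a, 'l::comm_ring_1) mpolynomial ring \<Rightarrow> 'a set \<Rightarrow> 'a set set \<Rightarrow> nat \<Rightarrow>
      ('a, 'l) mpolynomial set"
  where "stanley_reisner_symbolic_power S E Ind s =
    (\<Inter>B\<in>matroid_bases (dual_indep E Ind). var_ideal S B [^]\<^bsub>ideals_set S\<^esub> s)"

definition homogeneous_of_degree :: "nat \<Rightarrow> ('a, 'l::comm_ring_1) mpolynomial \<Rightarrow> bool" where
  "homogeneous_of_degree d p \<longleftrightarrow> (\<forall>m\<in>keys p. (\<Sum>i\<in>keys m. lookup m i) = d)"

definition initial_degree :: "('a, 'l::comm_ring_1) mpolynomial set \<Rightarrow> nat" where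
  "initial_degree I = (LEAST d. \<exists>p\<in>I. p \<noteq> 0 \<and> homogeneous_of_degree d p)"

text \<open>The argument is the sequence of symbolic powers of the ideal in question.\<close>

definition waldschmidt_constant :: "(nat \<Rightarrow> ('a, 'l::comm_ring_1) mpolynomial set) \<Rightarrow> real" where
  "waldschmidt_constant J = lim (\<lambda>s. real (initial_degree (J s)) / real s)"


section \<open>Primary decomposition of the Stanley-Reisner ideal\<close>

lemma mpoly_ring_simps [simp]:
  "carrier (mpoly_ring E) = {p. \<forall>m\<in>keys p. keys m \<subseteq> E}"
  "x \<otimes>\<^bsub>mpoly_ring E\<^esub> y = x * y" "x \<oplus>\<^bsub>mpoly_ring E\<^esub> y = x + y"
  "\<one>\<^bsub>mpoly_ring E\<^esub> = 1" "\<zero>\<^bsub>mpoly_ring E\<^esub> = 0"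
  by (simp_all add: mpoly_ring_def)

lemma mpoly_carrier_add:
  assumes "\<forall>m\<in>keys p. keys m \<subseteq> E" "\<forall>m\<in>keys q. keys m \<subseteq> E"
  shows "\<forall>m\<in>keys (p + q). keys m \<subseteq> E"
  using assms Poly_Mapping.keys_add[of p q] by blast

lemma mpoly_carrier_mult:
  fixes p q :: "('a, 'l::comm_ring_1) mpolynomial"
  assumes "\<forall>m\<in>keys p. keys m \<subseteq> E" "\<forall>m\<in>keys q. keys m \<subseteq> E"
  shows "\<forall>m\<in>keys (p * q). keys m \<subseteq> E"
proof
  fix m assume "m \<in> keys (p * q)"
  then obtain a b where ab: "m = a + b" "a \<in> keys p" "b \<in> keys q"
    using keys_mult[of p q] by blast
  then show "keys m \<subseteq> E"
    using assms Poly_Mapping.keys_add[of a b] by blast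
qed

lemma cring_mpoly_ring: "cring (mpoly_ring E :: ('a, 'l::comm_ring_1) mpolynomial ring)"
proof (rule cringI)
  show "abelian_group (mpoly_ring E :: ('a, 'l) mpolynomial ring)"
  proof (rule abelian_groupI)
    fix x :: "('a, 'l) mpolynomial"
    assume "x \<in> carrier (mpoly_ring E)"
    then show "\<exists>y\<in>carrier (mpoly_ring E). y \<oplus>\<^bsub>mpoly_ring E\<^esub> x = \<zero>\<^bsub>mpoly_ring E\<^esub>"
      by (intro bexI[of _ "- x"]) (auto simp: in_keys_iff)
  next
    fix x y :: "('a, 'l) mpolynomial"
    assume "x \<in> carrier (mpoly_ring E)" "y \<in> carrier (mpoly_ring E)"
    then show "x \<oplus>\<^bsub>mpoly_ring E\<^esub> y \<in> carrier (mpoly_ring E)"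
      using mpoly_carrier_add[of x E y] by simp
  qed (simp_all add: add_ac)
  show "comm_monoid (mpoly_ring E :: ('a, 'l) mpolynomial ring)"
  proof (rule comm_monoidI)
    fix x y :: "('a, 'l) mpolynomial"
    assume "x \<in> carrier (mpoly_ring E)" "y \<in> carrier (mpoly_ring E)"
    then show "x \<otimes>\<^bsub>mpoly_ring E\<^esub> y \<in> carrier (mpoly_ring E)"
      using mpoly_carrier_mult[of x E y] by simp
  qed (simp_all add: mult_ac)
qed (simp add: algebra_simps)

lemma mpoly_eq_sum_single: "p = (\<Sum>m\<in>keys p. Poly_Mapping.single m (lookup p m))"
  by (rule poly_mapping_eqI)
    (simp add: lookup_sum lookup_single when_def in_keys_iff)

lemma genideal_monomials:
  fixes T :: "('a \<Rightarrow>\<^sub>0 nat) set"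
  assumes T: "\<And>t. t \<in> T \<Longrightarrow> keys t \<subseteq> E"
  shows "Idl\<^bsub>mpoly_ring E\<^esub> ((\<lambda>t. Poly_Mapping.single t (1::'l::comm_ring_1)) ` T) =
    {p. \<forall>m\<in>keys p. keys m \<subseteq> E \<and> (\<exists>t\<in>T. \<exists>u. m = t + u)}" (is "?L = ?R")
proof
  interpret R: cring "mpoly_ring E :: ('a, 'l) mpolynomial ring" by (rule cring_mpoly_ring)
  let ?G = "(\<lambda>t. Poly_Mapping.single t (1::'l)) ` T"
  have G: "?G \<subseteq> carrier (mpoly_ring E)" using T by fastforce
  have mult: "p * q \<in> ?R" if p: "p \<in> ?R" and q: "\<forall>m\<in>keys q. keys m \<subseteq> E"
    for p q :: "('a, 'l) mpolynomial"
  proof -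
    have "keys m \<subseteq> E \<and> (\<exists>t\<in>T. \<exists>u. m = t + u)" if m: "m \<in> keys (p * q)" for m
    proof -
      obtain a b where ab: "m = a + b" "a \<in> keys p" "b \<in> keys q"
        using m keys_mult[of p q] by blast
      obtain t u where "t \<in> T" "a = t + u" "keys a \<subseteq> E" using ab p by blast
      then show ?thesis using ab q Poly_Mapping.keys_add[of a b]
        by (metis add.assoc le_sup_iff order_trans)
    qed
    then show ?thesis by blast
  qed
  have id: "ideal ?R (mpoly_ring E)"
  proof (rule idealI[OF R.ring_axioms])
    show "subgroup ?R (add_monoid (mpoly_ring E))"
    proof (rule R.add.subgroupI)
      fix a assume a: "a \<in> ?R"
      have "\<ominus>\<^bsub>mpoly_ring E\<^esub> a = - a"
        by (rule R.minus_equality) (use a in \<open>auto simp: in_keys_iff\<close>)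
      then show "\<ominus>\<^bsub>mpoly_ring E\<^esub> a \<in> ?R" using a by (auto simp: in_keys_iff)
    next
      show "?R \<noteq> {}" by (auto intro: exI[of _ 0])
    next
      fix a b assume "a \<in> ?R" "b \<in> ?R"
      then show "a \<oplus>\<^bsub>mpoly_ring E\<^esub> b \<in> ?R"
        using Poly_Mapping.keys_add[of a b] by (simp only: mpoly_ring_simps) blast
    qed auto
  next
    fix a x :: "('a, 'l) mpolynomial"
    assume a: "a \<in> ?R" and "x \<in> carrier (mpoly_ring E)"
    then have x: "\<forall>m\<in>keys x. keys m \<subseteq> E" by simp
    show "a \<otimes>\<^bsub>mpoly_ring E\<^esub> x \<in> ?R"
      unfolding mpoly_ring_simps by (rule mult[OF a x])
    show "x \<otimes>\<^bsub>mpoly_ring E\<^esub> a \<in> ?R"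
      unfolding mpoly_ring_simps by (subst mult.commute) (rule mult[OF a x])
  qed
  show "?L \<subseteq> ?R"
  proof (rule R.genideal_minimal[OF id])
    have "\<exists>t'\<in>T. \<exists>u. t = t' + u" if "t \<in> T" for t
      using that by (metis add.right_neutral)
    then show "?G \<subseteq> ?R" using T by (fastforce split: if_splits)
  qed
  show "?R \<subseteq> ?L"
  proof
    fix p assume p: "p \<in> ?R"
    interpret I: ideal ?L "mpoly_ring E" by (rule R.genideal_ideal[OF G])
    have mon: "Poly_Mapping.single m c \<in> ?L" if m: "m \<in> keys p" for m and c :: 'l
    proof -
      obtain t u where tu: "t \<in> T" "m = t + u" "keys m \<subseteq> E" using p m by blast
      have "keys u \<subseteq> keys m" unfolding tu by (auto simp: in_keys_iff lookup_add)
      then have "Poly_Mapping.single u c \<in> carrier (mpoly_ring E)" using tu by auto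
      moreover have "Poly_Mapping.single t 1 \<in> ?L" using R.genideal_self[OF G] tu by blast
      ultimately have "Poly_Mapping.single t 1 \<otimes>\<^bsub>mpoly_ring E\<^esub> Poly_Mapping.single u c \<in> ?L"
        by (rule I.I_r_closed[rotated])
      then show ?thesis by (simp add: tu mult_single)
    qed
    have "(\<Sum>m\<in>F. Poly_Mapping.single m (lookup p m)) \<in> ?L" if "finite F" "F \<subseteq> keys p" for F
      using that
    proof (induction F)
      case empty
      then show ?case using I.zero_closed by simp
    next
      case (insert m F)
      then show ?case using I.a_closed[OF mon, of m] by simp
    qed
    from this[OF finite_keys subset_refl] show "p \<in> ?L"
      unfolding mpoly_eq_sum_single[of p, symmetric] .
  qed
qed

lemma var_ideal_eq:
  assumes "U \<subseteq> E"
  shows "var_ideal (mpoly_ring E) U =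
    {p :: ('a, 'l::comm_ring_1) mpolynomial. \<forall>m\<in>keys p. keys m \<subseteq> E \<and> keys m \<inter> U \<noteq> {}}"
proof -
  have "mvar ` U =
      (\<lambda>t. Poly_Mapping.single t (1::'l)) ` ((\<lambda>i. Poly_Mapping.single i 1) ` U)"
    by (auto simp: mvar_def)
  moreover have "(\<exists>t\<in>(\<lambda>i. Poly_Mapping.single i 1) ` U. \<exists>u. m = t + u) \<longleftrightarrow> keys m \<inter> U \<noteq> {}"
    for m :: "'a \<Rightarrow>\<^sub>0 nat"
  proof
    assume "keys m \<inter> U \<noteq> {}"
    then obtain i where i: "i \<in> keys m" "i \<in> U" by blast
    have "m = Poly_Mapping.single i 1 + (m - Poly_Mapping.single i 1)"
      by (rule poly_mapping_eqI)
        (use i in \<open>auto simp: lookup_add lookup_minus lookup_single when_def in_keys_iff\<close>)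
    then show "\<exists>t\<in>(\<lambda>i. Poly_Mapping.single i 1) ` U. \<exists>u. m = t + u" using i by blast
  next
    assume "\<exists>t\<in>(\<lambda>i. Poly_Mapping.single i 1) ` U. \<exists>u. m = t + u"
    then obtain i u where i: "i \<in> U" "m = Poly_Mapping.single i 1 + u" by blast
    then have "i \<in> keys m" by (simp add: in_keys_iff lookup_add)
    then show "keys m \<inter> U \<noteq> {}" using i by blast
  qed
  ultimately show ?thesis
    unfolding var_ideal_def by (subst \<open>mvar ` U = _\<close>, subst genideal_monomials) (use assms in auto)
qed

lemma prod_mvar:
  "finite C \<Longrightarrow> (\<Prod>i\<in>C. mvar i) =
    Poly_Mapping.single (\<Sum>i\<in>C. Poly_Mapping.single i 1) (1::'l::comm_ring_1)"
  by (induction C rule: finite_induct) (simp_all add: mvar_def mult_single)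

lemma lookup_sum_single:
  "finite C \<Longrightarrow> lookup (\<Sum>i\<in>C. Poly_Mapping.single i (1::nat)) j = (if j \<in> C then 1 else 0)"
  by (simp add: lookup_sum lookup_single when_def)

context matroid
begin

lemma finite_indep: "X \<in> Ind \<Longrightarrow> finite X"
  using finite_ground indep_subset_ground finite_subset by blast

lemma card_indep_le: "X \<in> Ind \<Longrightarrow> card X \<le> card E"
  using finite_ground indep_subset_ground card_mono by blast

lemma card_indep_le_base:
  assumes "B \<in> matroid_bases Ind" "X \<in> Ind"
  shows "card X \<le> card B"
proof (rule ccontr)
  assume "\<not> card X \<le> card B"
  then obtain y where "y \<in> X - B" "insert y B \<in> Ind"
    using indep_augment[of B X] assms by (auto simp: matroid_bases_def)
  then show False using assms by (auto simp: matroid_bases_def)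
qed

lemma indep_extends_to_base:
  assumes "X \<in> Ind"
  shows "\<exists>B\<in>matroid_bases Ind. X \<subseteq> B"
proof -
  let ?P = "\<lambda>Y. Y \<in> Ind \<and> X \<subseteq> Y"
  have "?P X" using assms by simp
  moreover have "\<forall>Y. ?P Y \<longrightarrow> card Y < Suc (card E)"
    using card_indep_le by (simp add: less_Suc_eq_le)
  ultimately obtain B where B: "?P B" "\<And>Y. ?P Y \<Longrightarrow> card Y \<le> card B"
    using ex_has_greatest_nat[of ?P X card "Suc (card E)"] by blast
  have "Y = B" if "Y \<in> Ind" "B \<subseteq> Y" for Y
    using that B finite_indep card_seteq[of Y B] by (metis order_trans)
  then show ?thesis using B by (auto simp: matroid_bases_def)
qed

lemma dual_bases_eq: "matroid_bases (dual_indep E Ind) = (\<lambda>B. E - B) ` matroid_bases Ind"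
proof
  show "matroid_bases (dual_indep E Ind) \<subseteq> (\<lambda>B. E - B) ` matroid_bases Ind"
  proof
    fix D assume D: "D \<in> matroid_bases (dual_indep E Ind)"
    then obtain B where B: "B \<in> matroid_bases Ind" "D \<subseteq> E - B"
      by (auto simp: matroid_bases_def dual_indep_def)
    then have "E - B \<in> dual_indep E Ind" by (auto simp: dual_indep_def)
    then show "D \<in> (\<lambda>B. E - B) ` matroid_bases Ind"
      using D B by (auto simp: matroid_bases_def)
  qed
  show "(\<lambda>B. E - B) ` matroid_bases Ind \<subseteq> matroid_bases (dual_indep E Ind)"
  proof
    fix D assume "D \<in> (\<lambda>B. E - B) ` matroid_bases Ind"
    then obtain B where B: "B \<in> matroid_bases Ind" "D = E - B" by blast
    have "X = D" if X: "X \<in> dual_indep E Ind" "D \<subseteq> X" for X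
    proof -
      obtain B' where B': "B' \<in> matroid_bases Ind" "X \<subseteq> E - B'"
        using X by (auto simp: dual_indep_def)
      have "B' \<subseteq> B" using B B' X indep_subset_ground by (auto simp: matroid_bases_def)
      then have "B = B'" using B B' by (auto simp: matroid_bases_def)
      then show ?thesis using B B' X by blast
    qed
    then show "D \<in> matroid_bases (dual_indep E Ind)"
      using B by (auto simp: matroid_bases_def dual_indep_def)
  qed
qed

lemma dependent_contains_circuit:
  assumes "X \<subseteq> E" "X \<notin> Ind"
  shows "\<exists>C\<in>matroid_circuits E Ind. C \<subseteq> X"
proof -
  have fin: "finite X" using assms finite_ground finite_subset by blast
  let ?A = "{Y. Y \<subseteq> X \<and> Y \<notin> Ind}"
  have "finite ?A" "?A \<noteq> {}" using fin assms by auto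
  from finite_has_minimal[OF this]
  obtain C where C: "C \<in> ?A" "\<forall>Y\<in>?A. Y \<subseteq> C \<longrightarrow> C = Y" ..
  have "X' \<in> Ind" if "X' \<subset> C" for X'
    using C that by blast
  then have "C \<in> matroid_circuits E Ind"
    using C(1) assms(1) by (auto simp: matroid_circuits_def)
  then show ?thesis using C by blast
qed

lemma circuit_subset_iff_meets_dual_bases:
  assumes "X \<subseteq> E"
  shows "(\<exists>C\<in>matroid_circuits E Ind. C \<subseteq> X) \<longleftrightarrow>
    (\<forall>B\<in>matroid_bases (dual_indep E Ind). X \<inter> B \<noteq> {})"
proof -
  have "(\<exists>C\<in>matroid_circuits E Ind. C \<subseteq> X) \<longleftrightarrow> X \<notin> Ind"
    using dependent_contains_circuit[OF assms] indep_subset by (auto simp: matroid_circuits_def)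
  also have "X \<notin> Ind \<longleftrightarrow> (\<forall>B\<in>matroid_bases Ind. \<not> X \<subseteq> B)"
  proof
    assume "X \<notin> Ind"
    then show "\<forall>B\<in>matroid_bases Ind. \<not> X \<subseteq> B"
      using indep_subset[of _ X] by (auto simp: matroid_bases_def)
  next
    assume "\<forall>B\<in>matroid_bases Ind. \<not> X \<subseteq> B"
    then show "X \<notin> Ind" using indep_extends_to_base[of X] by blast
  qed
  also have "\<dots> \<longleftrightarrow> (\<forall>B\<in>matroid_bases (dual_indep E Ind). X \<inter> B \<noteq> {})"
    using assms by (auto simp: dual_bases_eq)
  finally show ?thesis .
qed

theorem stanley_reisner_ideal_eq_Inter:
  "stanley_reisner_ideal (mpoly_ring E :: ('a, 'l::comm_ring_1) mpolynomial ring) E Ind =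
    (\<Inter>B\<in>matroid_bases (dual_indep E Ind). var_ideal (mpoly_ring E) B)"
proof -
  let ?t = "\<lambda>C. \<Sum>i\<in>C. Poly_Mapping.single i (1::nat)"
  have fin: "finite C" if "C \<in> matroid_circuits E Ind" for C
    using that finite_ground finite_subset by (auto simp: matroid_circuits_def)
  have keys_t: "keys (?t C) = C" if "finite C" for C :: "'a set"
    using lookup_sum_single[OF that] by (auto simp: in_keys_iff split: if_splits)
  have gens: "{\<Prod>i\<in>C. mvar i | C. C \<in> matroid_circuits E Ind} =
      (\<lambda>t. Poly_Mapping.single t (1::'l)) ` (?t ` matroid_circuits E Ind)"
    (is "?A = ?B")
  proof
    show "?A \<subseteq> ?B" using prod_mvar[OF fin, where 'l = 'l] by blast
    show "?B \<subseteq> ?A" using prod_mvar[OF fin, where 'l = 'l, symmetric] by blast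
  qed
  have dvd: "(\<exists>t\<in>?t ` matroid_circuits E Ind. \<exists>u. m = t + u) \<longleftrightarrow>
      (\<exists>C\<in>matroid_circuits E Ind. C \<subseteq> keys m)" for m
  proof
    assume "\<exists>t\<in>?t ` matroid_circuits E Ind. \<exists>u. m = t + u"
    then obtain C u where C: "C \<in> matroid_circuits E Ind" "m = ?t C + u" by blast
    then have "C \<subseteq> keys m"
      using keys_t[OF fin[OF C(1)]] by (auto simp: in_keys_iff lookup_add)
    then show "\<exists>C\<in>matroid_circuits E Ind. C \<subseteq> keys m" using C by blast
  next
    assume "\<exists>C\<in>matroid_circuits E Ind. C \<subseteq> keys m"
    then obtain C where C: "C \<in> matroid_circuits E Ind" "C \<subseteq> keys m" by blast
    have "m = ?t C + (m - ?t C)"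
      by (rule poly_mapping_eqI)
        (use C in \<open>auto simp: lookup_add lookup_minus lookup_sum_single[OF fin[OF C(1)]] in_keys_iff
            simp del: One_nat_def\<close>)
    then show "\<exists>t\<in>?t ` matroid_circuits E Ind. \<exists>u. m = t + u" using C by blast
  qed
  have sub: "B \<subseteq> E" if "B \<in> matroid_bases (dual_indep E Ind)" for B
    using that by (auto simp: dual_bases_eq)
  have ne: "matroid_bases (dual_indep E Ind) \<noteq> {}"
    using indep_extends_to_base[OF indep_empty] by (auto simp: dual_bases_eq)
  have "stanley_reisner_ideal (mpoly_ring E :: ('a, 'l) mpolynomial ring) E Ind =
      {p. \<forall>m\<in>keys p. keys m \<subseteq> E \<and> (\<exists>t\<in>?t ` matroid_circuits E Ind. \<exists>u. m = t + u)}"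
    unfolding stanley_reisner_ideal_def gens
    by (rule genideal_monomials) (use keys_t fin in \<open>auto simp: matroid_circuits_def\<close>)
  also have "\<dots> = {p. \<forall>m\<in>keys p. keys m \<subseteq> E \<and>
      (\<forall>B\<in>matroid_bases (dual_indep E Ind). keys m \<inter> B \<noteq> {})}"
    unfolding dvd by (intro Collect_cong ball_cong refl conj_cong circuit_subset_iff_meets_dual_bases)
  also have "\<dots> = (\<Inter>B\<in>matroid_bases (dual_indep E Ind). var_ideal (mpoly_ring E) B)"
    using ne by (auto simp: var_ideal_eq[OF sub])
  finally show ?thesis .
qed

end

end

theory Submission
  imports Defs
begin

text \<open>A monomial \<open>x\<^sup>a\<close> lies in the \<open>s\<close>-th symbolic power iff \<open>a\<close> has weight at least \<open>s\<close> on the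
  complement of every basis. Decompose \<open>a\<close> into its superlevel sets \<open>U\<^sub>1 \<supseteq> U\<^sub>2 \<supseteq> \<dots>\<close>. As in the
  greedy algorithm, some basis \<open>B\<close> spans all of them simultaneously, so the weight of \<open>a\<close> off \<open>B\<close>
  is the sum of the nullities \<open>|U\<^sub>j| - rk U\<^sub>j\<close>, whereas the degree of \<open>a\<close> is the sum of the
  cardinalities \<open>|U\<^sub>j|\<close>. Comparing termwise bounds the ratio of degree and \<open>s\<close> from below by the
  minimum of \<open>d\<^sub>r / r\<close>. Multiples of the indicator vector of a set \<open>U\<close> attaining this minimum
  show that the bound is asymptotically sharp.\<close>

section \<open>Powers of ideals generated by variables\<close>

text \<open>A polynomial is the finite sum of its terms, so membership in an additively closed set
  can be checked term by term.\<close>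

lemma poly_mapping_sum_closed:
  fixes p :: "('a, 'l::comm_ring_1) mpolynomial"
  assumes "0 \<in> J" and "\<And>x y. x \<in> J \<Longrightarrow> y \<in> J \<Longrightarrow> x + y \<in> J"
    and "\<And>m. m \<in> keys p \<Longrightarrow> Poly_Mapping.single m (lookup p m) \<in> J"
  shows "p \<in> J"
proof -
  have "(\<Sum>m\<in>F. Poly_Mapping.single m (lookup p m)) \<in> J" if "finite F" "F \<subseteq> keys p" for F
    using that by (induction F) (use assms in auto)
  then show ?thesis using mpoly_eq_sum_single[of p] by (metis finite_keys subset_refl)
qed

text \<open>Each factor from \<open>var_ideal\<close> adds at least one to the degree in the
  variables of \<open>U\<close>. Conversely, a variable of \<open>U\<close> can be split off any
  term of positive degree in them. Power 0 is the whole ring.\<close>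

lemma var_ideal_power:
  assumes "U \<subseteq> E" "finite U"
  shows "var_ideal (mpoly_ring E) U [^]\<^bsub>ideals_set (mpoly_ring E)\<^esub> (s::nat) =
    {p :: ('a, 'l::comm_ring_1) mpolynomial.
      \<forall>m\<in>keys p. keys m \<subseteq> E \<and> s \<le> (\<Sum>i\<in>U. lookup m i)}"
proof (induction s)
  case 0
  show ?case by (simp add: ideals_set_def)
next
  case (Suc s)
  let ?R = "mpoly_ring E :: ('a, 'l) mpolynomial ring"
  let ?D = "\<lambda>s. {p :: ('a, 'l) mpolynomial. \<forall>m\<in>keys p. keys m \<subseteq> E \<and> s \<le> (\<Sum>i\<in>U. lookup m i)}"
  let ?V = "{p :: ('a, 'l) mpolynomial. \<forall>m\<in>keys p. keys m \<subseteq> E \<and> keys m \<inter> U \<noteq> {}}"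
  have "var_ideal ?R U [^]\<^bsub>ideals_set ?R\<^esub> Suc s = ideal_prod ?R (?D s) ?V"
    using Suc.IH var_ideal_eq[OF assms(1), where 'l = 'l] by (simp add: ideals_set_def)
  also have "\<dots> = ?D (Suc s)"
  proof
    have "keys m \<subseteq> E \<and> Suc s \<le> (\<Sum>i\<in>U. lookup m i)"
      if p: "p \<in> ideal_prod ?R (?D s) ?V" and m: "m \<in> keys p" for p m
      using p m
    proof (induction p arbitrary: m rule: ideal_prod.induct)
      case (prod p q)
      then obtain a b where ab: "m = a + b" "a \<in> keys p" "b \<in> keys q"
        using keys_mult[of p q] by auto
      have a: "keys a \<subseteq> E" "s \<le> (\<Sum>i\<in>U. lookup a i)" using prod ab by auto
      obtain i where i: "keys b \<subseteq> E" "i \<in> keys b" "i \<in> U" using prod ab by blast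
      have "1 \<le> lookup b i" using i by (simp add: in_keys_iff)
      also have "\<dots> \<le> (\<Sum>i\<in>U. lookup b i)"
        using i assms by (intro member_le_sum) auto
      finally show ?case
        using a i Poly_Mapping.keys_add[of a b] by (auto simp: ab lookup_add sum.distrib)
    next
      case (sum p q)
      then show ?case using Poly_Mapping.keys_add[of p q] by auto
    qed
    then show "ideal_prod ?R (?D s) ?V \<subseteq> ?D (Suc s)" by blast
  next
    show "?D (Suc s) \<subseteq> ideal_prod ?R (?D s) ?V"
    proof
      fix p assume p: "p \<in> ?D (Suc s)"
      show "p \<in> ideal_prod ?R (?D s) ?V"
      proof (rule poly_mapping_sum_closed)
        show "0 \<in> ideal_prod ?R (?D s) ?V"
          using ideal_prod.prod[of 0 "?D s" 0 ?V ?R] by simp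
      next
        fix x y assume "x \<in> ideal_prod ?R (?D s) ?V" "y \<in> ideal_prod ?R (?D s) ?V"
        then show "x + y \<in> ideal_prod ?R (?D s) ?V"
          using ideal_prod.sum[of x ?R "?D s" ?V y] by simp
      next
        fix m assume "m \<in> keys p"
        then have m: "keys m \<subseteq> E" "Suc s \<le> (\<Sum>i\<in>U. lookup m i)" using p by auto
        then have "\<exists>i\<in>U. lookup m i \<noteq> 0"
          by (metis Zero_not_Suc le_zero_eq sum.neutral)
        then obtain i where i: "i \<in> U" "i \<in> keys m" by (auto simp: in_keys_iff)
        let ?e = "Poly_Mapping.single i (1::nat)"
        \<comment> \<open>The truncated subtraction loses nothing, since \<open>i\<close> occurs in
          \<open>m\<close>.\<close>
        have split: "m = (m - ?e) + ?e"
          by (rule poly_mapping_eqI)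
            (use i in \<open>auto simp: lookup_add lookup_minus lookup_single when_def in_keys_iff\<close>)
        have "lookup m j = lookup (m - ?e) j + lookup ?e j" for j
          by (subst split) (rule lookup_add)
        then have "(\<Sum>j\<in>U. lookup m j) = (\<Sum>j\<in>U. lookup (m - ?e) j + lookup ?e j)"
          by (rule sum.cong[OF refl])
        also have "\<dots> = (\<Sum>j\<in>U. lookup (m - ?e) j) + (\<Sum>j\<in>U. lookup ?e j)"
          by (rule sum.distrib)
        finally have "(\<Sum>j\<in>U. lookup m j) =
          (\<Sum>j\<in>U. lookup (m - ?e) j) + (\<Sum>j\<in>U. lookup ?e j)" .
        moreover have "(\<Sum>j\<in>U. lookup ?e j) = 1"
          using i assms by (simp add: lookup_single when_def)
        ultimately have "s \<le> (\<Sum>j\<in>U. lookup (m - ?e) j)" using m by simp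
        moreover have "keys (m - ?e) \<subseteq> E"
          using m by (auto simp: in_keys_iff lookup_minus)
        ultimately have "Poly_Mapping.single (m - ?e) (lookup p m) \<in> ?D s" by auto
        moreover have "Poly_Mapping.single ?e 1 \<in> ?V" using i m by auto
        ultimately have "Poly_Mapping.single (m - ?e) (lookup p m) \<otimes>\<^bsub>?R\<^esub> Poly_Mapping.single ?e 1
            \<in> ideal_prod ?R (?D s) ?V"
          by (rule ideal_prod.prod)
        then show "Poly_Mapping.single m (lookup p m) \<in> ideal_prod ?R (?D s) ?V"
          by (simp only: mpoly_ring_simps mult_single mult_1_right split[symmetric])
      qed
    qed
  qed
  finally show ?case .
qed

section \<open>Bases adapted to a chain of sets\<close>

text \<open>Double counting of the pairs \<open>(i, j)\<close> with \<open>j < a i\<close>.\<close>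

lemma sum_eq_sum_card_superlevel:
  assumes "finite A" "\<And>i. i \<in> A \<Longrightarrow> a i \<le> N"
  shows "(\<Sum>i\<in>A. a i) = (\<Sum>j<N. card {i\<in>A. j < a i})"
proof -
  have "a i = (\<Sum>j<N. if j < a i then 1 else 0)" if "i \<in> A" for i
  proof -
    have "(\<Sum>j<N. if j < a i then 1 else 0) = card ({..<N} \<inter> {j. j < a i})"
      by (simp add: sum.If_cases)
    also have "{..<N} \<inter> {j. j < a i} = {..<a i}" using assms(2)[OF that] by auto
    finally show ?thesis by simp
  qed
  then have "(\<Sum>i\<in>A. a i) = (\<Sum>i\<in>A. \<Sum>j<N. if j < a i then 1 else 0)"
    by (rule sum.cong[OF refl])
  also have "\<dots> = (\<Sum>j<N. \<Sum>i\<in>A. if j < a i then 1 else 0)" by (rule sum.swap)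
  also have "\<dots> = (\<Sum>j<N. card {i\<in>A. j < a i})"
    using assms(1) by (simp add: sum.If_cases Int_def)
  finally show ?thesis .
qed

context matroid
begin

section \<open>Rank and extension of independent sets\<close>

lemma finite_Ind: "finite Ind"
  using finite_ground indep_subset_ground by (intro finite_subset[of Ind "Pow E"]) auto

lemma card_le_rank: "X \<in> Ind \<Longrightarrow> X \<subseteq> U \<Longrightarrow> card X \<le> matroid_rank Ind U"
  unfolding matroid_rank_def using finite_Ind by (intro Max_ge) auto

lemma rank_attained: "\<exists>X\<in>Ind. X \<subseteq> U \<and> card X = matroid_rank Ind U"
proof -
  have "matroid_rank Ind U \<in> card ` {X \<in> Ind. X \<subseteq> U}"
    unfolding matroid_rank_def using finite_Ind indep_empty by (intro Max_in) auto
  then show ?thesis by auto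
qed

lemma indep_extends_to_rank:
  assumes "X \<in> Ind" "X \<subseteq> U"
  shows "\<exists>Y\<in>Ind. X \<subseteq> Y \<and> Y \<subseteq> U \<and> card Y = matroid_rank Ind U"
proof -
  let ?P = "\<lambda>Y. Y \<in> Ind \<and> X \<subseteq> Y \<and> Y \<subseteq> U"
  have "?P X" using assms by simp
  moreover have "\<forall>Y. ?P Y \<longrightarrow> card Y < Suc (card E)"
    using card_indep_le by (simp add: less_Suc_eq_le)
  ultimately obtain Y where Y: "?P Y" "\<And>Z. ?P Z \<Longrightarrow> card Z \<le> card Y"
    using ex_has_greatest_nat[of ?P X card "Suc (card E)"] by blast
  obtain Z where Z: "Z \<in> Ind" "Z \<subseteq> U" "card Z = matroid_rank Ind U"
    using rank_attained by blast
  \<comment> \<open>Augmenting \<open>Y\<close> from \<open>Z\<close> would stay inside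
    \<open>U\<close> and contradict the maximality of \<open>Y\<close>.\<close>
  have "\<not> card Y < card Z"
  proof
    assume "card Y < card Z"
    then obtain y where y: "y \<in> Z - Y" "insert y Y \<in> Ind"
      using indep_augment[of Y Z] Y(1) Z(1) by blast
    then have "card (insert y Y) \<le> card Y" using Y Z(2) by blast
    then show False using y finite_indep[of Y] Y(1) by simp
  qed
  then have "card Y = matroid_rank Ind U" using Y(1) Z(3) card_le_rank[of Y U] by simp
  then show ?thesis using Y(1) by blast
qed

lemma card_base:
  assumes "B \<in> matroid_bases Ind"
  shows "card B = matroid_rank Ind E"
proof (rule antisym)
  have "B \<in> Ind" using assms by (simp add: matroid_bases_def)
  then show "card B \<le> matroid_rank Ind E" using card_le_rank indep_subset_ground by blast
  show "matroid_rank Ind E \<le> card B"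
    using rank_attained[of E] card_indep_le_base[OF assms] by metis
qed

text \<open>Greedy construction from the smallest set upwards: an independent set spanning the
  smaller members is extended to full rank in the next larger one, and enlarging it never lowers the
  earlier intersections.\<close>

lemma chain_spanned_by_indep:
  fixes U :: "nat \<Rightarrow> 'a set"
  assumes "\<And>j. j < N \<Longrightarrow> U j \<subseteq> V" and "antimono U"
  shows "\<exists>X\<in>Ind. X \<subseteq> V \<and> (\<forall>j<N. matroid_rank Ind (U j) \<le> card (X \<inter> U j))"
  using assms
proof (induction N arbitrary: U V)
  case 0
  then show ?case using indep_empty by blast
next
  case (Suc N)
  have anti: "U (Suc j) \<subseteq> U 0" "antimono (\<lambda>j. U (Suc j))" for j
    using Suc.prems(2) by (auto simp: antimono_def)
  \<comment> \<open>The tail of the chain lies in its largest member \<open>U 0\<close>, which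
    becomes the new ambient set.\<close>
  from Suc.IH[of "\<lambda>j. U (Suc j)" "U 0"] obtain X where X: "X \<in> Ind" "X \<subseteq> U 0"
    "\<And>j. j < N \<Longrightarrow> matroid_rank Ind (U (Suc j)) \<le> card (X \<inter> U (Suc j))"
    using anti by blast
  obtain Y where Y: "Y \<in> Ind" "X \<subseteq> Y" "Y \<subseteq> U 0" "card Y = matroid_rank Ind (U 0)"
    using indep_extends_to_rank[OF X(1,2)] by blast
  have "matroid_rank Ind (U j) \<le> card (Y \<inter> U j)" if "j < Suc N" for j
  proof (cases j)
    case 0
    then show ?thesis using Y by (simp add: Int_absorb2)
  next
    case (Suc i)
    then have "matroid_rank Ind (U j) \<le> card (X \<inter> U j)" using X(3) that by simp
    also have "\<dots> \<le> card (Y \<inter> U j)"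
      using Y finite_indep by (intro card_mono) auto
    finally show ?thesis .
  qed
  then show ?case using Y Suc.prems(1)[of 0] by blast
qed

text \<open>Extending the independent set of the previous lemma to a basis only shrinks the
  differences \<open>U j - B\<close>.\<close>

lemma chain_spanned_by_base:
  fixes U :: "nat \<Rightarrow> 'a set"
  assumes "\<And>j. U j \<subseteq> E" and "antimono U"
  shows "\<exists>B\<in>matroid_bases Ind. \<forall>j<N. card (U j - B) \<le> card (U j) - matroid_rank Ind (U j)"
proof -
  obtain X where X: "X \<in> Ind" "\<And>j. j < N \<Longrightarrow> matroid_rank Ind (U j) \<le> card (X \<inter> U j)"
    using chain_spanned_by_indep[of N U E] assms by blast
  obtain B where B: "B \<in> matroid_bases Ind" "X \<subseteq> B"
    using indep_extends_to_base[OF X(1)] by blast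
  have "card (U j - B) \<le> card (U j) - matroid_rank Ind (U j)" if "j < N" for j
  proof -
    have fin: "finite (U j)" using assms(1) finite_ground finite_subset by blast
    have "card (X \<inter> U j) \<le> card (U j \<inter> B)" using B fin by (intro card_mono) auto
    then show ?thesis using X(2)[OF that] fin by (simp add: card_Diff_subset_Int)
  qed
  then show ?thesis using B by blast
qed

text \<open>The superlevel sets of \<open>a\<close> form a chain, so one basis \<open>B\<close>
  bounds the weight off \<open>B\<close> by the sum of their nullities. The hypothesis on
  \<open>c\<close> is then applied level by level.\<close>

lemma weight_off_base_le:
  fixes c :: real
  assumes "0 \<le> c" and "\<And>U. U \<subseteq> E \<Longrightarrow> c * real (card U - matroid_rank Ind U) \<le> real (card U)"
  shows "\<exists>B\<in>matroid_bases Ind. c * real (\<Sum>i\<in>E - B. a i) \<le> real (\<Sum>i\<in>E. a i)"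
proof -
  \<comment> \<open>Inserting 0 keeps \<open>Max\<close> meaningful for empty
    \<open>E\<close>.\<close>
  define N where "N = Max (insert 0 (a ` E))"
  have N: "a i \<le> N" if "i \<in> E" for i
    using that finite_ground by (auto simp: N_def intro: Max_ge)
  define U where "U j = {i\<in>E. j < a i}" for j
  have "antimono U" by (auto simp: antimono_def U_def)
  then obtain B where B: "B \<in> matroid_bases Ind"
    "\<And>j. j < N \<Longrightarrow> card (U j - B) \<le> card (U j) - matroid_rank Ind (U j)"
    using chain_spanned_by_base[of U N] by (auto simp: U_def)
  have "(\<Sum>i\<in>E - B. a i) = (\<Sum>j<N. card {i\<in>E - B. j < a i})"
    using finite_ground N by (intro sum_eq_sum_card_superlevel) auto
  also have "\<dots> = (\<Sum>j<N. card (U j - B))"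
    by (intro sum.cong refl arg_cong[of _ _ card]) (auto simp: U_def)
  also have "\<dots> \<le> (\<Sum>j<N. card (U j) - matroid_rank Ind (U j))"
    using B by (intro sum_mono) auto
  finally have "c * real (\<Sum>i\<in>E - B. a i) \<le> c * real (\<Sum>j<N. card (U j) - matroid_rank Ind (U j))"
    using assms(1) by (intro mult_left_mono of_nat_mono)
  also have "\<dots> = (\<Sum>j<N. c * real (card (U j) - matroid_rank Ind (U j)))"
    by (simp add: sum_distrib_left)
  also have "\<dots> \<le> (\<Sum>j<N. real (card (U j)))"
    using assms(2) by (intro sum_mono) (auto simp: U_def)
  also have "\<dots> = real (\<Sum>i\<in>E. a i)"
    using sum_eq_sum_card_superlevel[OF finite_ground N] by (simp add: U_def)
  finally show ?thesis using B(1) by blast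
qed

section \<open>Generalized Hamming weights\<close>

lemma finite_weights: "finite {card U | U. U \<subseteq> E \<and> card U - matroid_rank Ind U = r}"
  using finite_ground by (simp add: setcompr_eq_image)

lemma gen_hamming_weight_le:
  "U \<subseteq> E \<Longrightarrow> gen_hamming_weight E Ind (card U - matroid_rank Ind U) \<le> card U"
  unfolding gen_hamming_weight_def by (rule Min_le[OF finite_weights]) auto

text \<open>A basis together with \<open>r\<close> further elements has nullity \<open>r\<close>, so
  the minimum is taken over a nonempty set.\<close>

lemma gen_hamming_weight_attained:
  assumes "r \<le> card E - matroid_rank Ind E"
  shows "\<exists>U\<subseteq>E. card U - matroid_rank Ind U = r \<and> card U = gen_hamming_weight E Ind r"
proof -
  obtain B where B: "B \<in> matroid_bases Ind"
    using indep_extends_to_base[OF indep_empty] by blast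
  have BE: "B \<in> Ind" "B \<subseteq> E" using B indep_subset_ground by (auto simp: matroid_bases_def)
  then have fin: "finite B" using finite_indep by blast
  have "r \<le> card (E - B)" using assms card_base[OF B] BE fin by (simp add: card_Diff_subset)
  then obtain T where T: "T \<subseteq> E - B" "card T = r" "finite T"
    using obtain_subset_with_card_n by metis
  have "matroid_rank Ind (B \<union> T) = card B"
    using card_le_rank[OF BE(1), of "B \<union> T"] rank_attained[of "B \<union> T"]
      card_indep_le_base[OF B] by (fastforce intro: antisym)
  moreover have "card (B \<union> T) = card B + r" using T fin by (subst card_Un_disjoint) auto
  ultimately have "B \<union> T \<subseteq> E \<and> card (B \<union> T) - matroid_rank Ind (B \<union> T) = r"
    using T BE by auto
  then have "{card U | U. U \<subseteq> E \<and> card U - matroid_rank Ind U = r} \<noteq> {}" by blast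
  from Min_in[OF finite_weights this] show ?thesis unfolding gen_hamming_weight_def by auto
qed

section \<open>The initial degree of the symbolic powers\<close>

lemma symbolic_power_eq:
  "stanley_reisner_symbolic_power (mpoly_ring E) E Ind s =
    {p :: ('a, 'l::comm_ring_1) mpolynomial. \<forall>m\<in>keys p. keys m \<subseteq> E \<and>
      (\<forall>B\<in>matroid_bases Ind. s \<le> (\<Sum>i\<in>E - B. lookup m i))}"
proof -
  \<comment> \<open>An intersection over no bases would be the whole type instead of the ring in the
    variables from \<open>E\<close>.\<close>
  have ne: "matroid_bases Ind \<noteq> {}"
    using indep_extends_to_base[OF indep_empty] by blast
  have "var_ideal (mpoly_ring E) (E - B) [^]\<^bsub>ideals_set (mpoly_ring E)\<^esub> s =
    {p :: ('a, 'l) mpolynomial. \<forall>m\<in>keys p. keys m \<subseteq> E \<and> s \<le> (\<Sum>i\<in>E - B. lookup m i)}" for B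
    by (rule var_ideal_power) (use finite_ground in auto)
  then have "stanley_reisner_symbolic_power (mpoly_ring E) E Ind s = (\<Inter>B\<in>matroid_bases Ind.
    {p :: ('a, 'l) mpolynomial. \<forall>m\<in>keys p. keys m \<subseteq> E \<and> s \<le> (\<Sum>i\<in>E - B. lookup m i)})"
    by (simp add: stanley_reisner_symbolic_power_def dual_bases_eq)
  then show ?thesis using ne by blast
qed

text \<open>One monomial of \<open>p\<close> suffices: its exponent has weight at least
  \<open>s\<close> off every basis, in particular off the one from
  \<open>weight_off_base_le\<close>, and its total weight is \<open>d\<close>.\<close>

lemma initial_degree_ge:
  fixes c :: real
  assumes "0 \<le> c" and "\<And>U. U \<subseteq> E \<Longrightarrow> c * real (card U - matroid_rank Ind U) \<le> real (card U)"
    and p: "p \<in> stanley_reisner_symbolic_power (mpoly_ring E) E Ind s" "p \<noteq> 0"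
      "homogeneous_of_degree d (p :: ('a, 'l::comm_ring_1) mpolynomial)"
  shows "c * real s \<le> real d"
proof -
  obtain m where m: "m \<in> keys p" using p(2) by (metis ex_in_conv keys_eq_empty)
  have mE: "keys m \<subseteq> E" and
    ms: "\<And>B. B \<in> matroid_bases Ind \<Longrightarrow> s \<le> (\<Sum>i\<in>E - B. lookup m i)"
    using p(1) m by (auto simp: symbolic_power_eq)
  obtain B where B: "B \<in> matroid_bases Ind"
    "c * real (\<Sum>i\<in>E - B. lookup m i) \<le> real (\<Sum>i\<in>E. lookup m i)"
    using weight_off_base_le[OF assms(1,2)] by blast
  have "c * real s \<le> c * real (\<Sum>i\<in>E - B. lookup m i)"
    using ms[OF B(1)] assms(1) by (intro mult_left_mono of_nat_mono)
  also note B(2)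
  also have "(\<Sum>i\<in>E. lookup m i) = (\<Sum>i\<in>keys m. lookup m i)"
    using mE finite_ground by (intro sum.mono_neutral_right) (auto simp: in_keys_iff)
  also have "\<dots> = d" using p(3) m by (simp add: homogeneous_of_degree_def)
  finally show ?thesis .
qed

text \<open>The witness is the \<open>t\<close>-th power of the product of the variables in
  \<open>U\<close>. A basis contains at most rank many elements of \<open>U\<close>, so the weight
  off it is at least \<open>t\<close> times the nullity.\<close>

lemma indicator_monomial_in_symbolic_power:
  assumes "U \<subseteq> E" "s \<le> t * (card U - matroid_rank Ind U)"
  shows "\<exists>p\<in>stanley_reisner_symbolic_power (mpoly_ring E) E Ind s.
    (p :: ('a, 'l::comm_ring_1) mpolynomial) \<noteq> 0 \<and> homogeneous_of_degree (t * card U) p"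
proof -
  define m where "m = (\<Sum>i\<in>U. Poly_Mapping.single i t)"
  have fin: "finite U" using assms finite_ground finite_subset by blast
  have lookup: "lookup m i = (if i \<in> U then t else 0)" for i
    using fin by (simp add: m_def lookup_sum lookup_single when_def)
  have keys: "keys m \<subseteq> U" by (auto simp: in_keys_iff lookup split: if_splits)
  have "s \<le> (\<Sum>i\<in>E - B. lookup m i)" if B: "B \<in> matroid_bases Ind" for B
  proof -
    have "card (U \<inter> B) \<le> matroid_rank Ind U"
      using B indep_subset[of B "U \<inter> B"] by (intro card_le_rank) (auto simp: matroid_bases_def)
    then have "card U - matroid_rank Ind U \<le> card (U - B)"
      using fin by (simp add: card_Diff_subset_Int)
    then have "s \<le> t * card (U - B)"
      using assms(2) by (meson le_trans mult_le_mono2)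
    also have "\<dots> = (\<Sum>i\<in>U - B. lookup m i)" by (simp add: lookup)
    also have "\<dots> \<le> (\<Sum>i\<in>E - B. lookup m i)"
      using assms(1) finite_ground by (intro sum_mono2) auto
    finally show ?thesis .
  qed
  then have "Poly_Mapping.single m (1::'l) \<in>
      stanley_reisner_symbolic_power (mpoly_ring E) E Ind s"
    using keys assms(1) by (auto simp: symbolic_power_eq)
  moreover have "homogeneous_of_degree (t * card U) (Poly_Mapping.single m (1::'l))"
  proof -
    have "(\<Sum>i\<in>keys m. lookup m i) = (\<Sum>i\<in>U. lookup m i)"
      using keys fin by (intro sum.mono_neutral_left) (auto simp: in_keys_iff)
    also have "\<dots> = t * card U" by (simp add: lookup)
    finally show ?thesis by (simp add: homogeneous_of_degree_def)
  qed
  moreover have "Poly_Mapping.single m (1::'l) \<noteq> 0"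
    by (metis lookup_single_eq lookup_zero zero_neq_one)
  ultimately show ?thesis by blast
qed

text \<open>With \<open>c\<close> the minimum and \<open>U\<close> a set attaining it, the initial
  degree lies between \<open>c * s\<close> and \<open>c * s + card U\<close>.\<close>

theorem waldschmidt_constant_eq_Min:
  assumes "matroid_rank Ind E < card E"
  shows "waldschmidt_constant
      (stanley_reisner_symbolic_power (mpoly_ring E :: ('a, 'l::comm_ring_1) mpolynomial ring) E Ind) =
    Min ((\<lambda>r. real (gen_hamming_weight E Ind r) / real r) ` {1..card E - matroid_rank Ind E})"
proof -
  let ?J = "stanley_reisner_symbolic_power (mpoly_ring E :: ('a, 'l) mpolynomial ring) E Ind"
  let ?f = "\<lambda>r. real (gen_hamming_weight E Ind r) / real r"
  define c where "c = Min (?f ` {1..card E - matroid_rank Ind E})"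
  have "c \<in> ?f ` {1..card E - matroid_rank Ind E}"
    unfolding c_def using assms by (intro Min_in) auto
  then obtain r where r: "1 \<le> r" "r \<le> card E - matroid_rank Ind E" "c = ?f r" by auto
  obtain U where U: "U \<subseteq> E" "card U - matroid_rank Ind U = r" "card U = gen_hamming_weight E Ind r"
    using gen_hamming_weight_attained[OF r(2)] by blast
  have c0: "0 \<le> c" using r by simp
  have ratio: "c * real (card V - matroid_rank Ind V) \<le> real (card V)" if V: "V \<subseteq> E" for V
  proof (cases "card V - matroid_rank Ind V = 0")
    case False
    define q where "q = card V - matroid_rank Ind V"
    \<comment> \<open>The chain E, V, V, ... yields a basis \<open>B\<close> with
      \<open>E - B\<close> no larger than the nullity of \<open>E\<close>. As \<open>q\<close> is at
      most the size of \<open>V - B\<close>, it lies in the range of the minimum.\<close>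
    let ?W = "\<lambda>j::nat. if j = 0 then E else V"
    have "?W j \<subseteq> E" "antimono ?W" for j using V by (auto simp: antimono_def)
    from chain_spanned_by_base[OF this, of "Suc (Suc 0)"]
    obtain B where B: "B \<in> matroid_bases Ind"
      "card (V - B) \<le> card V - matroid_rank Ind V" "card (E - B) \<le> card E - matroid_rank Ind E"
      by (auto simp: less_Suc_eq all_conj_distrib)
    have "card (V \<inter> B) \<le> matroid_rank Ind V"
      using B indep_subset[of B "V \<inter> B"] by (intro card_le_rank) (auto simp: matroid_bases_def)
    then have "q \<le> card (V - B)"
      using V finite_ground finite_subset[of V E] by (simp add: q_def card_Diff_subset_Int)
    also have "\<dots> \<le> card (E - B)" using V finite_ground by (intro card_mono) auto
    finally have "q \<in> {1..card E - matroid_rank Ind E}" using B False by (simp add: q_def)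
    then have "c \<le> ?f q" unfolding c_def by (intro Min_le) auto
    then have "c * real q \<le> real (gen_hamming_weight E Ind q)"
      using False by (simp add: q_def field_simps)
    then show ?thesis using gen_hamming_weight_le[OF V] by (simp add: q_def)
  qed simp
  have lower: "c * real s \<le> real (initial_degree (?J s))" for s
  proof -
    \<comment> \<open>\<open>LEAST\<close> needs a witness; the exponent \<open>s\<close> works
      because \<open>r\<close> is at least 1.\<close>
    have "\<exists>d. \<exists>p\<in>?J s. p \<noteq> 0 \<and> homogeneous_of_degree d p"
      using indicator_monomial_in_symbolic_power[OF U(1), of s s] r U by auto
    from LeastI_ex[OF this] show ?thesis
      unfolding initial_degree_def using initial_degree_ge[OF c0 ratio] by blast
  qed
  have upper: "real (initial_degree (?J s)) \<le> c * real s + real (card U)" for s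
  proof -
    \<comment> \<open>Rounding \<open>s / r\<close> up in this way costs at most one extra copy of
      \<open>U\<close> in the degree.\<close>
    have "s \<le> (s div r + 1) * r"
      using dividend_less_times_div[of r s] r by (simp add: mult.commute)
    then have "\<exists>p\<in>?J s. p \<noteq> 0 \<and> homogeneous_of_degree ((s div r + 1) * card U) p"
      using indicator_monomial_in_symbolic_power[OF U(1)] U(2) by blast
    then have "initial_degree (?J s) \<le> (s div r + 1) * card U"
      unfolding initial_degree_def by (rule Least_le)
    then have "real (initial_degree (?J s)) \<le> real ((s div r + 1) * card U)"
      by (simp only: of_nat_le_iff)
    also have "\<dots> = (real (s div r) + 1) * real (card U)" by (simp add: algebra_simps)
    also have "\<dots> \<le> (real s / real r + 1) * real (card U)"
      by (intro mult_right_mono add_right_mono of_nat_div_le_of_nat) simp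
    also have "\<dots> = c * real s + real (card U)" using r U by (simp add: field_simps)
    finally show ?thesis .
  qed
  have "(\<lambda>s. real (initial_degree (?J s)) / real s) \<longlonglongrightarrow> c"
  proof (rule tendsto_sandwich[where f = "\<lambda>_. c" and h = "\<lambda>s. c + real (card U) / real s"])
    \<comment> \<open>Only positive \<open>s\<close> count: at 0 the quotient is 0 by
      convention.\<close>
    show "eventually (\<lambda>s. c \<le> real (initial_degree (?J s)) / real s) sequentially"
      using eventually_gt_at_top[of 0] by eventually_elim (use lower in \<open>simp add: field_simps\<close>)
    show "eventually (\<lambda>s. real (initial_degree (?J s)) / real s \<le> c + real (card U) / real s)
        sequentially"
      using eventually_gt_at_top[of 0] by eventually_elim (use upper in \<open>simp add: field_simps\<close>)
    show "(\<lambda>s. c + real (card U) / real s) \<longlonglongrightarrow> c"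
      using tendsto_add[OF tendsto_const lim_const_over_n] by simp
  qed simp
  \<comment> \<open>Convergence has been proved, so \<open>lim\<close> denotes the actual
    limit.\<close>
  then show ?thesis unfolding waldschmidt_constant_def c_def by (rule limI)
qed

end

theorem theorem3p4:
  fixes n k :: nat and Ind :: "nat set set"
    and S :: "(nat, 'l::field) mpolynomial ring"
  assumes "matroid {1..n} Ind"
    and "matroid_rank Ind {1..n} = k"
    and "k < n"
    and "S = mpoly_ring {1..n}"
  shows "waldschmidt_constant (stanley_reisner_symbolic_power S {1..n} Ind) =
    Min ((\<lambda>r. real (gen_hamming_weight {1..n} Ind r) / real r) ` {1..n - k})"
  using matroid.waldschmidt_constant_eq_Min[OF assms(1), where 'l = 'l] assms by simp

end
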